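(* If $G$ is any of the following graphs, then $\bar{\gamma}_p(G)=0$: (1) $\overline{C_n}$ for $n\ge 5$; (2) $\overline{P_n}$ for $n\ge 4$; (3) the cycle $C_n=v_1v_2\cdots v_nv_1$ together with the $k$ chords $\{v_1,v_i\},\{v_1,v_{i+1}\},\dots,\{v_1,v_{i+k-1}\}$, where $i\ge 3$, $n\ge 4$ and $i+k\le n-1$; (4) the cycle $C_n=v_1v_2\cdots v_nv_1$ together with the $k+1$ chords $\{v_1,v_i\},\{v_1,v_{i+1}\},\dots,\{v_1,v_{i+k-1}\}$ and $\{v_2,v_{i-1}\}$, where $i\ge 5$, $n\ge 6$ and $i+k\le n-1$; (5) $G'\vee H$, where $\bar{\gamma}_p(G')=0$ and either $\bar{\gamma}_p(H)=0$ or $H=\overline{K_2}$.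
   Context: $\overline{G}$ denotes the complement graph; $C_n$, $P_n$ are the cycle and path on $n$ vertices; $\overline{K_2}$ is two vertices with no edge; $G'\vee H$ is the join (disjoint union plus all edges between $V(G')$ and $V(H)$). For $v\in V$, $N[v]$ is the closed neighborhood; for $S\subseteq V$, $N[S]=\bigcup_{v\in S}N[v]$. Define $\mathcal{P}^0(S)=N[S]$, $\mathcal{P}^{i+1}(S)=\mathcal{P}^i(S)\cup\{w : \{w\}=N[v]\setminus\mathcal{P}^i(S)\text{ for some } v\in\mathcal{P}^i(S)\}$, with eventual value $\mathcal{P}^\infty(S)$. $S$ is a power dominating set (PDS) if $\mathcal{P}^\infty(S)=V$, and a failed power dominating set (FPDS) otherwise. $\bar{\gamma}_p(G)$ is the maximum cardinality of an FPDS of $G$. *)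

theory Defs
  imports "Graph_Theory.Graph_Theory"
begin

text \<open>
  Undirected graphs are symmetric loop-free digraphs on \<open>pair_pre_digraph\<close>, as in
  the session \<open>Graph_Theory\<close>. The null graph is excluded: it has no failed power dominating set, so the
  maximum defining \<open>failed_pd_number\<close> would not exist.
\<close>

definition simple_graph :: "'a pair_pre_digraph \<Rightarrow> bool" where
  "simple_graph G \<longleftrightarrow> pair_graph G \<and> pverts G \<noteq> {}"

abbreviation graph_iso :: "'a pair_pre_digraph \<Rightarrow> 'b pair_pre_digraph \<Rightarrow> bool" where
  "graph_iso G H \<equiv> digraph_iso (with_proj G) (with_proj H)"

text \<open>
  Edge sets are sets of two-element sets; each edge contributes both of its orientations.
\<close>

definition add_edges :: "'a pair_pre_digraph \<Rightarrow> 'a set set \<Rightarrow> 'a pair_pre_digraph" where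
  "add_edges G E = G\<lparr>parcs := parcs G \<union> {(u, v). {u, v} \<in> E}\<rparr>"

definition undirected :: "'a set \<Rightarrow> 'a set set \<Rightarrow> 'a pair_pre_digraph" where
  "undirected V E = add_edges \<lparr>pverts = V, parcs = {}\<rparr> E"

definition path_graph :: "nat \<Rightarrow> nat pair_pre_digraph" where
  "path_graph n = undirected {1..n} {{j, j + 1} | j. 1 \<le> j \<and> j < n}"

text \<open>Intended for \<open>n \<ge> 3\<close>; smaller values do not give cycles.\<close>

definition cycle_graph :: "nat \<Rightarrow> nat pair_pre_digraph" where
  "cycle_graph n = add_edges (path_graph n) {{n, 1}}"

definition complement_graph :: "'a pair_pre_digraph \<Rightarrow> 'a pair_pre_digraph" where
  "complement_graph G =
    \<lparr>pverts = pverts G,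
     parcs = {(u, v) \<in> pverts G \<times> pverts G. u \<noteq> v \<and> (u, v) \<notin> parcs G}\<rparr>"

definition complete_graph :: "nat \<Rightarrow> nat pair_pre_digraph" where
  "complete_graph n = \<lparr>pverts = {1..n}, parcs = {(u, v) \<in> {1..n} \<times> {1..n}. u \<noteq> v}\<rparr>"

definition join_graph ::
  "'a pair_pre_digraph \<Rightarrow> 'b pair_pre_digraph \<Rightarrow> ('a + 'b) pair_pre_digraph" where
  "join_graph G H =
    \<lparr>pverts = pverts G <+> pverts H,
     parcs = map_prod Inl Inl ` parcs G \<union> map_prod Inr Inr ` parcs H
       \<union> Inl ` pverts G \<times> Inr ` pverts H \<union> Inr ` pverts H \<times> Inl ` pverts G\<rparr>"

definition closed_nbhd :: "'a pair_pre_digraph \<Rightarrow> 'a \<Rightarrow> 'a set" where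
  "closed_nbhd G v = insert v {w. (v, w) \<in> parcs G}"

fun observed :: "'a pair_pre_digraph \<Rightarrow> 'a set \<Rightarrow> nat \<Rightarrow> 'a set" where
  "observed G S 0 = (\<Union>v\<in>S. closed_nbhd G v)"
| "observed G S (Suc i) =
    observed G S i \<union> {w. \<exists>v\<in>observed G S i. closed_nbhd G v - observed G S i = {w}}"

text \<open>
  The sequence \<open>observed G S\<close> increases, so its eventual value is its union
  (\<open>observed_eventually\<close> below).
\<close>

definition observed_inf :: "'a pair_pre_digraph \<Rightarrow> 'a set \<Rightarrow> 'a set" where
  "observed_inf G S = (\<Union>i. observed G S i)"

definition power_dominating :: "'a pair_pre_digraph \<Rightarrow> 'a set \<Rightarrow> bool" where
  "power_dominating G S \<longleftrightarrow> S \<subseteq> pverts G \<and> observed_inf G S = pverts G"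

definition failed_power_dominating :: "'a pair_pre_digraph \<Rightarrow> 'a set \<Rightarrow> bool" where
  "failed_power_dominating G S \<longleftrightarrow> S \<subseteq> pverts G \<and> \<not> power_dominating G S"

definition failed_pd_number :: "'a pair_pre_digraph \<Rightarrow> nat" where
  "failed_pd_number G = Max (card ` {S. failed_power_dominating G S})"

lemma closed_nbhd_subset:
  assumes "simple_graph G" and "v \<in> pverts G"
  shows "closed_nbhd G v \<subseteq> pverts G"
proof -
  interpret pair_graph G using assms(1) by (simp add: simple_graph_def)
  show ?thesis using assms(2) by (auto simp: closed_nbhd_def dest: in_arcsD2)
qed

lemma observed_subset:
  assumes "simple_graph G" and "S \<subseteq> pverts G"
  shows "observed G S i \<subseteq> pverts G"
proof (induction i)
  case 0
  then show ?case using closed_nbhd_subset[OF assms(1)] assms(2) by auto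
next
  case (Suc i)
  then show ?case using closed_nbhd_subset[OF assms(1)] by auto
qed

lemma observed_eventually:
  assumes "simple_graph G" and "S \<subseteq> pverts G"
  shows "\<forall>\<^sub>F i in sequentially. observed G S i = observed_inf G S"
proof -
  have mono: "mono (observed G S)"
    by (rule mono_iff_le_Suc[THEN iffD2]) auto
  have fin: "finite (observed_inf G S)"
    unfolding observed_inf_def
    using observed_subset[OF assms] assms(1)
    by (meson UN_least finite_subset simple_graph_def pair_graph.axioms(1) pair_digraph.axioms(1)
        pair_fin_digraph.pair_finite_verts)
  have "\<exists>k. \<forall>i\<ge>k. w \<in> observed G S i" if "w \<in> observed_inf G S" for w
    using that mono by (auto simp: observed_inf_def dest: monoD)
  then have "\<forall>w\<in>observed_inf G S. \<forall>\<^sub>F i in sequentially. w \<in> observed G S i"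
    by (auto simp: eventually_sequentially)
  then have "\<forall>\<^sub>F i in sequentially. \<forall>w\<in>observed_inf G S. w \<in> observed G S i"
    using fin by (simp add: eventually_ball_finite)
  then show ?thesis
    by eventually_elim (auto simp: observed_inf_def)
qed

text \<open>The empty set fails, so the maximum in \<open>failed_pd_number\<close> ranges over a finite nonempty set.\<close>

lemma failed_pd_number_attained:
  assumes "simple_graph G"
  shows "\<exists>S. failed_power_dominating G S \<and> card S = failed_pd_number G"
    and "failed_power_dominating G S \<Longrightarrow> card S \<le> failed_pd_number G"
proof -
  interpret pair_graph G using assms by (simp add: simple_graph_def)
  have "observed G {} i = {}" for i by (induction i) auto
  then have "failed_power_dominating G {}"
    using assms
    by (auto simp: failed_power_dominating_def power_dominating_def observed_inf_def simple_graph_def)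
  moreover have "{S. failed_power_dominating G S} \<subseteq> Pow (pverts G)"
    by (auto simp: failed_power_dominating_def)
  then have fin: "finite {S. failed_power_dominating G S}"
    using pair_finite_verts finite_subset by blast
  ultimately have "failed_pd_number G \<in> card ` {S. failed_power_dominating G S}"
    unfolding failed_pd_number_def by (intro Max_in) auto
  then show "\<exists>S. failed_power_dominating G S \<and> card S = failed_pd_number G" by auto
  show "failed_power_dominating G S \<Longrightarrow> card S \<le> failed_pd_number G"
    using fin unfolding failed_pd_number_def by (intro Max_ge) auto
qed

end

theory Submission
  imports Defs
begin

text \<open>
  The number vanishes iff every single vertex is a power dominating set, that is, iff every set which
  contains a closed neighbourhood and admits no forcing step is everything. In the complement of a
  cycle or path a vertex misses at most two vertices, and a vertex at distance two in the cycle or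
  path is non-adjacent to one of them and so forces the other. In a cycle with chords the forcing
  runs along the cycle in both directions, because a chord end is passed once the other end is
  observed. In a join, a vertex of one part observes the other part at once, so the forcing within
  its own part is undisturbed.
\<close>

section \<open>Closed sets and the vanishing criterion\<close>

definition forcing_closed :: "'a pair_pre_digraph \<Rightarrow> 'a set \<Rightarrow> bool" where
  "forcing_closed G X \<longleftrightarrow> (\<forall>v\<in>X. \<forall>w. closed_nbhd G v - X \<noteq> {w})"

text \<open>Phrased through closed supersets rather than through the stages \<open>observed\<close>,
  so that later arguments need no step counts. The set \<open>X\<close> is not confined to the
  vertices, hence the inclusion at the end.\<close>

definition singletons_dominate :: "'a pair_pre_digraph \<Rightarrow> bool" where
  "singletons_dominate G \<longleftrightarrow>
    (\<forall>v\<in>pverts G. \<forall>X. closed_nbhd G v \<subseteq> X \<longrightarrow> forcing_closed G X \<longrightarrow> pverts G \<subseteq> X)"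

lemma singletons_dominateD:
  assumes "singletons_dominate G" "v \<in> pverts G" "closed_nbhd G v \<subseteq> X" "forcing_closed G X"
  shows "pverts G \<subseteq> X"
  using assms unfolding singletons_dominate_def by blast

text \<open>The usable form of a force: it suffices that every other closed neighbour of
  \<open>v\<close> lies in \<open>X\<close>, without deciding beforehand whether \<open>w\<close>
  does.\<close>

lemma forcing_closedD:
  assumes "forcing_closed G X" "v \<in> X" "w \<in> closed_nbhd G v" "closed_nbhd G v \<subseteq> insert w X"
  shows "w \<in> X"
proof (rule ccontr)
  assume "w \<notin> X"
  then have "closed_nbhd G v - X = {w}" using assms(3,4) by blast
  then show False using assms(1,2) by (simp add: forcing_closed_def)
qed

text \<open>Induction on stages: a vertex forced at some stage is the only closed neighbour outside
  a subset of \<open>X\<close>, so \<open>X\<close> would be forced to contain it too. With the next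
  lemma, \<open>observed_inf G S\<close> is the least closed set containing the neighbourhood of
  \<open>S\<close>.\<close>

lemma observed_subset_forcing_closed:
  assumes "(\<Union>v\<in>S. closed_nbhd G v) \<subseteq> X" "forcing_closed G X"
  shows "observed_inf G S \<subseteq> X"
proof -
  have "observed G S i \<subseteq> X" for i
  proof (induction i)
    case 0
    show ?case using assms(1) by simp
  next
    case (Suc i)
    have "w \<in> X" if "v \<in> observed G S i" "closed_nbhd G v - observed G S i = {w}" for v w
      using forcing_closedD[OF assms(2), of v w] that Suc by blast
    then show ?case using Suc by auto
  qed
  then show ?thesis by (auto simp: observed_inf_def)
qed

text \<open>The stages become constant, and a force still possible at the limit would enlarge the
  following stage.\<close>

lemma forcing_closed_observed_inf:
  assumes "simple_graph G" "S \<subseteq> pverts G"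
  shows "forcing_closed G (observed_inf G S)"
proof -
  obtain i where i: "\<And>j. j \<ge> i \<Longrightarrow> observed G S j = observed_inf G S"
    using observed_eventually[OF assms] by (auto simp: eventually_sequentially)
  have "closed_nbhd G v - observed_inf G S \<noteq> {w}" if "v \<in> observed_inf G S" for v w
  proof
    assume *: "closed_nbhd G v - observed_inf G S = {w}"
    then have "w \<in> observed G S (Suc i)" using that i[of i] by auto
    then show False using i[of "Suc i"] * by auto
  qed
  then show ?thesis by (simp add: forcing_closed_def)
qed

text \<open>A failing singleton would give a maximum of at least 1. Conversely, a nonempty
  \<open>S\<close> observes at least what any one of its vertices observes, so a failed set
  attaining the maximum is empty.\<close>

lemma failed_pd_number_eq_0_iff:
  assumes "simple_graph G"
  shows "failed_pd_number G = 0 \<longleftrightarrow> singletons_dominate G"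
proof
  assume 0: "failed_pd_number G = 0"
  show "singletons_dominate G"
    unfolding singletons_dominate_def
  proof (intro ballI allI impI)
    fix v X assume v: "v \<in> pverts G" "closed_nbhd G v \<subseteq> X" "forcing_closed G X"
    have "\<not> failed_power_dominating G {v}"
      using failed_pd_number_attained(2)[OF assms, where S = "{v}"] 0 by auto
    then have "observed_inf G {v} = pverts G"
      using v(1) by (simp add: failed_power_dominating_def power_dominating_def)
    then show "pverts G \<subseteq> X"
      using observed_subset_forcing_closed[where S = "{v}" and X = X] v by auto
  qed
next
  assume *: "singletons_dominate G"
  obtain S where S: "failed_power_dominating G S" "card S = failed_pd_number G"
    using failed_pd_number_attained(1)[OF assms] by blast
  have sub: "S \<subseteq> pverts G" using S(1) by (simp add: failed_power_dominating_def)
  have "S = {}"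
  proof (rule ccontr)
    assume "S \<noteq> {}"
    then obtain v where v: "v \<in> S" by blast
    have "observed G S 0 \<subseteq> observed_inf G S"
      unfolding observed_inf_def by blast
    then have "closed_nbhd G v \<subseteq> observed_inf G S" using v by auto
    then have "pverts G \<subseteq> observed_inf G S"
      using singletons_dominateD[OF * _ _ forcing_closed_observed_inf[OF assms sub]] v sub by blast
    moreover have "observed_inf G S \<subseteq> pverts G"
      using observed_subset[OF assms sub] by (auto simp: observed_inf_def)
    ultimately show False
      using S(1) by (auto simp: failed_power_dominating_def power_dominating_def)
  qed
  then show "failed_pd_number G = 0" using S(2) by simp
qed

section \<open>Transfer along embeddings and isomorphisms\<close>

text \<open>A closed set of \<open>J\<close> pulls back to a closed set of \<open>H\<close>. The set
  \<open>B\<close> collects neighbours common to all images: the other part in a join, nothing for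
  an isomorphism.\<close>

lemma singletons_dominate_embedding:
  assumes "singletons_dominate H"
    and nbhd_sub: "\<And>u. u \<in> pverts H \<Longrightarrow> closed_nbhd H u \<subseteq> pverts H"
    and "inj_on f (pverts H)"
    and nbhd_eq: "\<And>u. u \<in> pverts H \<Longrightarrow> closed_nbhd J (f u) = f ` closed_nbhd H u \<union> B"
    and "v \<in> pverts H" "closed_nbhd J (f v) \<subseteq> X" "forcing_closed J X"
  shows "f ` pverts H \<subseteq> X"
proof -
  define Y where "Y = {u \<in> pverts H. f u \<in> X}"
  \<comment> \<open>\<open>B\<close> is part of the closed neighbourhood of the start
    \<open>f v\<close>, so it never obstructs a force.\<close>
  have B: "B \<subseteq> X" using assms(5,6) nbhd_eq by blast
  have "forcing_closed H Y"
    unfolding forcing_closed_def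
  proof (intro ballI allI notI)
    fix u w assume u: "u \<in> Y" and *: "closed_nbhd H u - Y = {w}"
    then have uV: "u \<in> pverts H" and fu: "f u \<in> X" by (auto simp: Y_def)
    have w: "w \<in> closed_nbhd H u" "w \<in> pverts H" "w \<notin> Y" using * nbhd_sub[OF uV] by auto
    have "closed_nbhd J (f u) \<subseteq> insert (f w) X"
      using * B nbhd_eq[OF uV] by (auto simp: Y_def)
    then have "f w \<in> X"
      using forcing_closedD[OF assms(7) fu] w nbhd_eq[OF uV] by blast
    then show False using w by (simp add: Y_def)
  qed
  moreover have "closed_nbhd H v \<subseteq> Y"
    using assms(5,6) nbhd_sub[OF assms(5)] nbhd_eq[OF assms(5)] by (auto simp: Y_def)
  ultimately have "pverts H \<subseteq> Y" using singletons_dominateD[OF assms(1,5)] by blast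
  then show ?thesis by (auto simp: Y_def)
qed

text \<open>A digraph isomorphism also relabels arcs and replaces the end maps. Both graphs here
  have \<open>fst\<close> and \<open>snd\<close> as end maps, so the vertex map determines the arc
  map.\<close>

lemma graph_isoE:
  assumes "graph_iso G H" "simple_graph G"
  obtains f where "inj_on f (pverts G)" "pverts H = f ` pverts G"
    "\<And>u. u \<in> pverts G \<Longrightarrow> closed_nbhd H (f u) = f ` closed_nbhd G u"
proof -
  interpret pair_graph G using assms(2) by (simp add: simple_graph_def)
  obtain h where h: "digraph_isomorphism h" and H: "with_proj H = app_iso h (with_proj G)"
    using assms(1) by (auto simp: digraph_iso_def)
  define f where "f = iso_verts h"
  have inj: "inj_on f (pverts G)" using h by (simp add: digraph_isomorphism_def f_def)
  have V: "pverts H = f ` pverts G" using arg_cong[OF H, of verts] by (simp add: f_def)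
  have t: "iso_tail h = fst" "iso_head h = snd"
    using arg_cong[OF H, of tail] arg_cong[OF H, of head] by simp_all
  have "iso_arcs h a = (f (fst a), f (snd a))" if "a \<in> parcs G" for a
    using h that by (simp add: digraph_isomorphism_def f_def t prod_eq_iff)
  then have A: "parcs H = (\<lambda>a. (f (fst a), f (snd a))) ` parcs G"
    using arg_cong[OF H, of arcs] by (simp cong: image_cong)
  have "closed_nbhd H (f u) = f ` closed_nbhd G u" if u: "u \<in> pverts G" for u
  proof -
    have "(f u, w) \<in> parcs H \<longleftrightarrow> (\<exists>w'. (u, w') \<in> parcs G \<and> w = f w')" for w
      using inj_onD[OF inj] u in_arcsD1 unfolding A by (auto simp: image_iff Bex_def) metis+
    then show ?thesis by (auto simp: closed_nbhd_def)
  qed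
  then show thesis using that inj V by blast
qed

lemma singletons_dominate_iso:
  assumes "graph_iso G H" "simple_graph G" "singletons_dominate H"
  shows "singletons_dominate G"
  unfolding singletons_dominate_def
proof (intro ballI allI impI)
  fix v X assume v: "v \<in> pverts G" "closed_nbhd G v \<subseteq> X" "forcing_closed G X"
  obtain f where f: "inj_on f (pverts G)" "pverts H = f ` pverts G"
    "\<And>u. u \<in> pverts G \<Longrightarrow> closed_nbhd H (f u) = f ` closed_nbhd G u"
    using graph_isoE[OF assms(1,2)] by metis
  \<comment> \<open>Domination is carried from \<open>H\<close> back to \<open>G\<close>, so the
    embedding in question is the inverse of \<open>f\<close>.\<close>
  define g where "g = the_inv_into (pverts G) f"
  have gf: "g (f u) = u" if "u \<in> pverts G" for u
    using f(1) that by (simp add: g_def the_inv_into_f_f)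
  have nb: "closed_nbhd G u \<subseteq> pverts G" if "u \<in> pverts G" for u
    using closed_nbhd_subset[OF assms(2) that] .
  have gimg: "g ` f ` A = A" if "A \<subseteq> pverts G" for A
    using gf that by (force simp: image_iff)
  have "g ` pverts H \<subseteq> X"
  proof (rule singletons_dominate_embedding[OF assms(3), where B = "{}" and v = "f v" and J = G])
    show "closed_nbhd H u \<subseteq> pverts H" if "u \<in> pverts H" for u
    proof -
      from that obtain x where "x \<in> pverts G" "u = f x" using f(2) by auto
      then show ?thesis using f(2,3) nb by (simp add: image_mono)
    qed
    show "inj_on g (pverts H)"
      using gf f(2) by (auto simp: inj_on_def)
    show "closed_nbhd G (g u) = g ` closed_nbhd H u \<union> {}" if "u \<in> pverts H" for u
    proof -
      from that obtain x where "x \<in> pverts G" "u = f x" using f(2) by auto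
      then show ?thesis using f(3) gf gimg nb by simp
    qed
  qed (use v f(2) gf in auto)
  then show "pverts G \<subseteq> X" using gimg f(2) by simp
qed

section \<open>Joins\<close>

lemma closed_nbhd_join_Inl:
  "v \<in> pverts G \<Longrightarrow> closed_nbhd (join_graph G H) (Inl v) = Inl ` closed_nbhd G v \<union> Inr ` pverts H"
  by (auto simp: closed_nbhd_def join_graph_def)

lemma closed_nbhd_join_Inr:
  "v \<in> pverts H \<Longrightarrow> closed_nbhd (join_graph G H) (Inr v) = Inr ` closed_nbhd H v \<union> Inl ` pverts G"
  by (auto simp: closed_nbhd_def join_graph_def)

lemma singletons_dominate_join:
  fixes G :: "'b pair_pre_digraph" and H :: "'c pair_pre_digraph"
  assumes G: "simple_graph G" "singletons_dominate G" and H: "simple_graph H"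
    and "singletons_dominate H \<or> graph_iso H (complement_graph (complete_graph 2))"
  shows "singletons_dominate (join_graph G H)"
  unfolding singletons_dominate_def
proof (intro ballI allI impI)
  fix x X
  assume x: "x \<in> pverts (join_graph G H)" and X: "closed_nbhd (join_graph G H) x \<subseteq> X"
    and closed: "forcing_closed (join_graph G H) X"
  have V: "pverts (join_graph G H) = Inl ` pverts G \<union> Inr ` pverts H"
    by (auto simp: join_graph_def)
  from x consider v where "v \<in> pverts G" "x = Inl v" | v where "v \<in> pverts H" "x = Inr v"
    unfolding V by blast
  then show "pverts (join_graph G H) \<subseteq> X"
  proof cases
    case 1
    have "Inl ` pverts G \<subseteq> X"
      by (rule singletons_dominate_embedding[OF G(2) closed_nbhd_subset[OF G(1)] _
            closed_nbhd_join_Inl _ _ closed, of v]) (use 1 X in auto)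
    then show ?thesis using 1 X by (auto simp: V closed_nbhd_join_Inl)
  next
    case 2
    have XG: "Inl ` pverts G \<subseteq> X" using 2 X by (auto simp: closed_nbhd_join_Inr)
    have "Inr ` pverts H \<subseteq> X"
      using assms(4)
    proof
      assume "singletons_dominate H"
      then show ?thesis
        by (rule singletons_dominate_embedding[OF _ closed_nbhd_subset[OF H] _
              closed_nbhd_join_Inr _ _ closed, of v]) (use 2 X in auto)
    next
      assume "graph_iso H (complement_graph (complete_graph 2))"
      then obtain f where "inj_on f (pverts H)"
        "pverts (complement_graph (complete_graph 2)) = f ` pverts H"
        using graph_isoE[OF _ H] by metis
      \<comment> \<open>The isomorphism enters through the vertex count: besides \<open>v\<close>,
        \<open>H\<close> has exactly one further vertex \<open>w\<close>.\<close>
      then have "card (pverts H) = card (pverts (complement_graph (complete_graph 2)))"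
        using card_image by metis
      then have "card (pverts H) = 2"
        by (simp add: complement_graph_def complete_graph_def)
      then obtain w where w: "pverts H = {v, w}"
        using 2(1) by (auto simp: card_2_iff doubleton_eq_iff)
      obtain g where g: "g \<in> pverts G" using G(1) by (auto simp: simple_graph_def)
      \<comment> \<open>All of the \<open>G\<close> part and \<open>Inr v\<close> are observed, so
        any vertex \<open>g\<close> of \<open>G\<close> can lack only \<open>Inr w\<close> and
        forces it.\<close>
      have "closed_nbhd (join_graph G H) (Inl g) \<subseteq> insert (Inr w) X"
        using XG X 2 w closed_nbhd_subset[OF G(1) g]
        by (auto simp: closed_nbhd_join_Inl[OF g] closed_nbhd_def[of _ "Inr v"])
      then have "Inr w \<in> X"
        using forcing_closedD[OF closed, of "Inl g" "Inr w"] g XG w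
        by (auto simp: closed_nbhd_join_Inl)
      then show ?thesis using X 2 w by (auto simp: closed_nbhd_def)
    qed
    then show ?thesis using XG by (simp add: V)
  qed
qed

section \<open>Complements of cycles and paths\<close>

lemma pverts_cycle_graph [simp]: "pverts (cycle_graph n) = {1..n}"
  and pverts_path_graph [simp]: "pverts (path_graph n) = {1..n}"
  and pverts_add_edges [simp]: "pverts (add_edges G E) = pverts G"
  and pverts_complement_graph [simp]: "pverts (complement_graph G) = pverts G"
  by (simp_all add: cycle_graph_def path_graph_def undirected_def add_edges_def complement_graph_def)

lemma parcs_path_graph:
  "(u, v) \<in> parcs (path_graph n) \<longleftrightarrow> 1 \<le> u \<and> u < n \<and> v = u + 1 \<or> 1 \<le> v \<and> v < n \<and> u = v + 1"
  by (auto simp: path_graph_def undirected_def add_edges_def doubleton_eq_iff)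

lemma parcs_add_edges: "(u, v) \<in> parcs (add_edges G E) \<longleftrightarrow> (u, v) \<in> parcs G \<or> {u, v} \<in> E"
  by (auto simp: add_edges_def)

lemma parcs_cycle_graph:
  "(u, v) \<in> parcs (cycle_graph n) \<longleftrightarrow>
    1 \<le> u \<and> u < n \<and> v = u + 1 \<or> 1 \<le> v \<and> v < n \<and> u = v + 1 \<or> u = n \<and> v = 1 \<or> u = 1 \<and> v = n"
  by (auto simp: cycle_graph_def parcs_add_edges parcs_path_graph doubleton_eq_iff)

lemma closed_nbhd_complement:
  assumes "v \<in> pverts G"
  shows "w \<in> closed_nbhd (complement_graph G) v \<longleftrightarrow> w = v \<or> w \<in> pverts G \<and> (v, w) \<notin> parcs G"
  using assms by (auto simp: closed_nbhd_def complement_graph_def)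

lemma singletons_dominate_complement_cycle:
  assumes "n \<ge> 5"
  shows "singletons_dominate (complement_graph (cycle_graph n))"
  unfolding singletons_dominate_def
proof (intro ballI allI impI)
  let ?G = "complement_graph (cycle_graph n)"
  fix v X assume v: "v \<in> pverts ?G" and X: "closed_nbhd ?G v \<subseteq> X" and closed: "forcing_closed ?G X"
  \<comment> \<open>\<open>s\<close> and \<open>p\<close> are the cyclic successor and predecessor
    on \<open>{1..n}\<close>; they are the two vertices that \<open>v\<close> misses.\<close>
  define s where "s j = (if j = n then 1 else j + 1)" for j
  define p where "p j = (if j = 1 then n else j - 1)" for j
  have nb: "w \<in> closed_nbhd ?G u \<longleftrightarrow> w \<in> {1..n} \<and> w \<noteq> s u \<and> w \<noteq> p u" if "u \<in> {1..n}" for u w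
    using that assms by (auto simp: closed_nbhd_complement parcs_cycle_graph s_def p_def)
  have v: "v \<in> {1..n}" using v by simp
  have XV: "w \<in> X" if "w \<in> {1..n}" "w \<noteq> s v" "w \<noteq> p v" for w
    using X nb[OF v] that by blast
  \<comment> \<open>The vertex two steps ahead misses \<open>s v\<close> but sees
    \<open>p v\<close>, hence forces \<open>p v\<close>. The inequality
    \<open>s (s (s v)) \<noteq> p v\<close> expresses that visibility and would fail for
    \<open>n = 4\<close>.\<close>
  have ss: "s (s v) \<in> {1..n}" "s (s v) \<noteq> s v" "s (s v) \<noteq> p v" "p (s (s v)) = s v"
      "s (s (s v)) \<noteq> p v" "s v \<noteq> p v" "s v \<in> {1..n}"
    using v assms by (auto simp: s_def p_def split: if_splits)
  have pp: "p (p v) \<in> {1..n}" "p (p v) \<noteq> s v" "p (p v) \<noteq> p v" "s (p (p v)) = p v"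
      "p (p (p v)) \<noteq> s v" "p v \<in> {1..n}"
    using v assms by (auto simp: s_def p_def split: if_splits)
  have "p v \<in> X"
  proof (rule forcing_closedD[OF closed XV[OF ss(1-3)]])
    show "p v \<in> closed_nbhd ?G (s (s v))" using nb[OF ss(1)] ss pp by metis
    show "closed_nbhd ?G (s (s v)) \<subseteq> insert (p v) X"
      using nb[OF ss(1)] XV ss(4) by (metis insertI1 insertI2 subsetI)
  qed
  moreover have "s v \<in> X"
  proof (rule forcing_closedD[OF closed XV[OF pp(1-3)]])
    show "s v \<in> closed_nbhd ?G (p (p v))" using nb[OF pp(1)] ss pp by metis
    show "closed_nbhd ?G (p (p v)) \<subseteq> insert (s v) X"
      using nb[OF pp(1)] XV pp(4) by (metis insertI1 insertI2 subsetI)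
  qed
  ultimately show "pverts ?G \<subseteq> X"
    using XV by (metis pverts_complement_graph pverts_cycle_graph subsetI)
qed

text \<open>An end of the path misses one vertex only. An interior start misses two, and a vertex
  two steps away forces one of them; this reduces every case to a single missing vertex.\<close>

lemma singletons_dominate_complement_path:
  assumes "n \<ge> 4"
  shows "singletons_dominate (complement_graph (path_graph n))"
  unfolding singletons_dominate_def
proof (intro ballI allI impI)
  let ?G = "complement_graph (path_graph n)"
  fix v X assume v: "v \<in> pverts ?G" and X: "closed_nbhd ?G v \<subseteq> X" and closed: "forcing_closed ?G X"
  have nb: "w \<in> closed_nbhd ?G u \<longleftrightarrow> w \<in> {1..n} \<and> w \<noteq> u + 1 \<and> u \<noteq> w + 1" if "u \<in> {1..n}" for u w
    using that by (auto simp: closed_nbhd_complement parcs_path_graph)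
  have v: "v \<in> {1..n}" using v by simp
  have XV: "w \<in> X" if "w \<in> {1..n}" "w \<noteq> v + 1" "v \<noteq> w + 1" for w
    using X nb[OF v] that by blast
  have force: "w \<in> X"
    if "u \<in> X" "u \<in> {1..n}" "w \<in> {1..n}" "w \<noteq> u + 1" "u \<noteq> w + 1"
      "\<And>z. z \<in> {1..n} \<Longrightarrow> z \<noteq> u + 1 \<Longrightarrow> u \<noteq> z + 1 \<Longrightarrow> z \<noteq> w \<Longrightarrow> z \<in> X" for u w
    using forcing_closedD[OF closed that(1), of w] nb[OF that(2)] that by blast
  \<comment> \<open>An end of the path that is neither the missing vertex \<open>w\<close> nor next
    to it forces \<open>w\<close>: \<open>n\<close> serves for \<open>w \<le> 2\<close>, since
    \<open>n \<ge> 4\<close>, and \<open>1\<close> otherwise.\<close>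
  have one_missing: "{1..n} \<subseteq> X" if "w \<in> {1..n}" "\<And>z. z \<in> {1..n} \<Longrightarrow> z \<noteq> w \<Longrightarrow> z \<in> X" for w
  proof -
    have "w \<in> X"
    proof (cases "w \<le> 2")
      case True
      then show ?thesis by (intro force[of n w] that(2)) (use that(1) assms in auto)
    next
      case False
      then show ?thesis by (intro force[of 1 w] that(2)) (use that(1) assms in auto)
    qed
    then show ?thesis using that by blast
  qed
  consider "v = 1" | "v = n" | "1 < v" "v + 2 \<le> n" | "1 < v" "v + 1 = n"
    using v unfolding atLeastAtMost_iff by linarith
  then have "{1..n} \<subseteq> X"
  proof cases
    case 1
    show ?thesis by (rule one_missing[of 2]) (use XV 1 assms in auto)
  next
    case 2
    show ?thesis by (rule one_missing[of "n - 1"]) (use XV 2 assms in auto)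
  next
    case 3
    have "v - 1 \<in> X" by (rule force[of "v + 2"]) (use XV 3 assms in auto)
    then have "z \<in> X" if "z \<in> {1..n}" "z \<noteq> v + 1" for z
      using XV[of z] that by (cases "v = z + 1") auto
    then show ?thesis by (intro one_missing[of "v + 1"]) (use 3 in auto)
  next
    case 4
    \<comment> \<open>Here \<open>v + 2\<close> is not a vertex, so \<open>v - 2\<close> forces
      instead; \<open>n \<ge> 4\<close> makes it a vertex.\<close>
    obtain u where u: "v = u + 2" "1 \<le> u" using that[of "v - 2"] 4 assms by simp
    have XV': "z \<in> X" if "1 \<le> z" "z \<le> u + 2" "z \<noteq> u + 1" for z
      using XV[of z] that u 4 by simp
    have "u + 3 \<in> X"
      by (rule force[of u]) (use u 4 in \<open>auto intro!: XV'\<close>)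
    then have "z \<in> X" if "z \<in> {1..n}" "z \<noteq> u + 1" for z
      using XV'[of z] that u 4 by (cases "z = u + 3") simp_all
    then show ?thesis using u 4 by (intro one_missing[of "u + 1"]) simp_all
  qed
  then show "pverts ?G \<subseteq> X" by simp
qed

section \<open>Cycles with chords\<close>

text \<open>Each \<open>j\<close> in turn forces \<open>j + 1\<close>; its remaining neighbours may
  lie in the block swept so far or, like the far end of a chord, anywhere in
  \<open>X\<close>.\<close>

lemma forcing_ascending:
  fixes a b c :: nat
  assumes "forcing_closed G X" "c \<le> a" "{c..a} \<subseteq> X"
    and "\<And>j. a \<le> j \<Longrightarrow> j < b \<Longrightarrow> j + 1 \<in> closed_nbhd G j"
    and "\<And>j. a \<le> j \<Longrightarrow> j < b \<Longrightarrow> closed_nbhd G j \<subseteq> X \<union> {c..j + 1}"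
  shows "{c..b} \<subseteq> X"
proof (cases "a \<le> b")
  case True
  then show ?thesis
    using assms(4,5)
  proof (induction b rule: dec_induct)
    case base
    show ?case using assms(3) .
  next
    case (step m)
    then have X: "{c..m} \<subseteq> X" by simp
    have eq: "{c..m + 1} = insert (m + 1) {c..m}" using assms(2) step(1) by auto
    have "m \<in> X" using X assms(2) step(1) by auto
    then have "m + 1 \<in> X"
      using forcing_closedD[OF assms(1)] step.prems[of m] step(1) X eq by auto
    then show ?case using X eq by simp
  qed
next
  case False
  then have "{c..b} \<subseteq> {c..a}" by simp
  then show ?thesis using assms(3) by blast
qed

text \<open>The mirror image: \<open>j + 1\<close> forces \<open>j\<close>, and the top
  \<open>c\<close> stays fixed.\<close>

lemma forcing_descending:
  fixes a b c :: nat
  assumes "forcing_closed G X" "b \<le> c" "{b..c} \<subseteq> X"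
    and "\<And>j. a \<le> j \<Longrightarrow> j < b \<Longrightarrow> j \<in> closed_nbhd G (j + 1)"
    and "\<And>j. a \<le> j \<Longrightarrow> j < b \<Longrightarrow> closed_nbhd G (j + 1) \<subseteq> X \<union> {j..c}"
  shows "{a..c} \<subseteq> X"
proof (cases "a \<le> b")
  case True
  then show ?thesis
    using assms(4,5)
  proof (induction a rule: inc_induct)
    case base
    show ?case using assms(3) .
  next
    case (step m)
    then have X: "{m + 1..c} \<subseteq> X" by simp
    have eq: "{m..c} = insert m {m + 1..c}" using assms(2) step(2) by auto
    have "m + 1 \<in> X" using X assms(2) step(2) by auto
    then have "m \<in> X"
      using forcing_closedD[OF assms(1)] step.prems[of m] step(2) X eq by auto
    then show ?case using X eq by simp
  qed
next
  case False
  then have "{a..c} \<subseteq> {b..c}" by simp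
  then show ?thesis using assms(3) by blast
qed

lemma atLeastAtMost_add_1: "{a..a + 1} = {a, a + 1 :: nat}"
  by auto

lemma singletons_dominate_cycle_fan:
  assumes "i \<ge> 3" "n \<ge> 4" "i + k \<le> n - 1"
  shows "singletons_dominate (add_edges (cycle_graph n) {{1, j} | j. i \<le> j \<and> j < i + k})"
proof -
  define G where "G = add_edges (cycle_graph n) {{1, j} | j. i \<le> j \<and> j < i + k}"
  have "pverts G \<subseteq> X"
    if "v \<in> pverts G" and X: "closed_nbhd G v \<subseteq> X" and closed: "forcing_closed G X" for v X
  proof -
    have v: "1 \<le> v" "v \<le> n" using that by (simp_all add: G_def)
    have ikn: "i + k < n" using assms by simp
    have nb: "w \<in> closed_nbhd G u \<longleftrightarrow>
        w = u \<or> 1 \<le> u \<and> u < n \<and> w = u + 1 \<or> 1 \<le> w \<and> w < n \<and> u = w + 1 \<or>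
        u = n \<and> w = 1 \<or> u = 1 \<and> w = n \<or> u = 1 \<and> i \<le> w \<and> w < i + k \<or> w = 1 \<and> i \<le> u \<and> u < i + k" for u w
      by (auto simp: G_def closed_nbhd_def parcs_add_edges parcs_cycle_graph doubleton_eq_iff)
    have nbv: "w \<in> X" if "w \<in> closed_nbhd G v" for w using that X by blast
    \<comment> \<open>A fan end also sees \<open>1\<close>, so a sweep must either have
      \<open>1\<close> observed or avoid using fan ends as forcers. The forcers are
      \<open>a + 1\<close> and above in \<open>up\<close>, and \<open>b\<close> and below in
      \<open>down\<close>.\<close>
    have up: "{a..n} \<subseteq> X"
      if "1 \<le> a" "a \<in> X" "a + 1 \<in> X" "1 \<in> X \<or> i + k \<le> a + 1" for a
      by (rule forcing_ascending[OF closed, where a = "a + 1"])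
        (use that ikn in \<open>auto simp: nb atLeastAtMost_add_1[simplified]\<close>)
    have down: "{1..b + 1} \<subseteq> X" if "b < n" "b + 1 \<in> X" "b \<in> X" "1 \<in> X \<or> b < i" for b
      by (rule forcing_descending[OF closed, where b = b])
        (use that ikn in \<open>auto simp: nb atLeastAtMost_add_1[simplified]\<close>)
    \<comment> \<open>Once \<open>1\<close> and two consecutive vertices are observed, both sweeps
      run freely. A start below the fan descends to \<open>1\<close>, a fan end sees
      \<open>1\<close>, and a start beyond the fan ascends to \<open>n\<close>.\<close>
    obtain b where b: "1 \<le> b" "b < n" "b \<in> X" "b + 1 \<in> X" and "1 \<in> X"
    proof (cases "v < i + k")
      case True
      have vX: "v \<in> X" "v + 1 \<in> X" using True v ikn by (auto intro!: nbv simp: nb)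
      have "1 \<in> X"
      proof (cases "v < i")
        case True
        then have "{1..v + 1} \<subseteq> X" using vX v ikn by (intro down) auto
        then show ?thesis by auto
      next
        case False
        then show ?thesis using True by (auto intro!: nbv simp: nb)
      qed
      then show thesis using that[of v] vX v True ikn by simp
    next
      case False
      obtain u where u: "v = u + 1" "1 \<le> u" using False assms(1) by (cases v) auto
      have uX: "u \<in> X" "u + 1 \<in> X" using u v by (auto intro!: nbv simp: nb)
      have high: "{u..n} \<subseteq> X" by (rule up) (use False u uX in auto)
      then have n: "n \<in> X" "n - 1 \<in> X" using u v by auto
      \<comment> \<open>As \<open>i + k < n\<close>, no chord ends at \<open>n\<close>, whose only
        neighbours are thus \<open>n - 1\<close> and \<open>1\<close>.\<close>
      then have "1 \<in> X"
        by (intro forcing_closedD[OF closed n(1)]) (use ikn in \<open>auto simp: nb\<close>)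
      then show thesis using that[of u] u uX v by simp
    qed
    then have "{1..b + 1} \<subseteq> X" "{b..n} \<subseteq> X" using up down by auto
    moreover have "x \<in> {1..b + 1} \<or> x \<in> {b..n}" if "x \<in> {1..n}" for x using that by auto
    ultimately have "{1..n} \<subseteq> X" by blast
    then show ?thesis by (simp add: G_def)
  qed
  then show ?thesis unfolding G_def singletons_dominate_def by blast
qed

lemma singletons_dominate_cycle_fan_chord:
  assumes "i \<ge> 5" "n \<ge> 6" "i + k \<le> n - 1"
  shows "singletons_dominate (add_edges (cycle_graph n)
    ({{1, j} | j. i \<le> j \<and> j < i + k} \<union> {{2, i - 1}}))"
proof -
  \<comment> \<open>With \<open>m = i - 2\<close> the extra chord joins \<open>2\<close> and
    \<open>m + 1\<close> and the fan starts at \<open>m + 2\<close>, free of truncated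
    subtraction.\<close>
  obtain m where m: "i = m + 2" "3 \<le> m" using that[of "i - 2"] assms(1) by simp
  define G where "G = add_edges (cycle_graph n) ({{1, j} | j. i \<le> j \<and> j < i + k} \<union> {{2, i - 1}})"
  have "pverts G \<subseteq> X"
    if "v \<in> pverts G" and X: "closed_nbhd G v \<subseteq> X" and closed: "forcing_closed G X" for v X
  proof -
    have v: "1 \<le> v" "v \<le> n" using that by (simp_all add: G_def)
    have mkn: "m + 2 + k < n" using assms m by simp
    have nb: "w \<in> closed_nbhd G u \<longleftrightarrow>
        w = u \<or> 1 \<le> u \<and> u < n \<and> w = u + 1 \<or> 1 \<le> w \<and> w < n \<and> u = w + 1 \<or>
        u = n \<and> w = 1 \<or> u = 1 \<and> w = n \<or> u = 1 \<and> m + 2 \<le> w \<and> w < m + 2 + k \<or>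
        w = 1 \<and> m + 2 \<le> u \<and> u < m + 2 + k \<or> u = 2 \<and> w = m + 1 \<or> w = 2 \<and> u = m + 1" for u w
      by (auto simp: G_def m closed_nbhd_def parcs_add_edges parcs_cycle_graph doubleton_eq_iff)
    have nbv: "w \<in> X" if "w \<in> closed_nbhd G v" for w using that X by blast
    \<comment> \<open>The extra chord splits the cycle: the forcers of the low sweeps lie in
      \<open>{3..m}\<close> and meet no chord, those of the high sweeps lie in
      \<open>{m + 2..n}\<close> and meet only chords to \<open>1\<close>.\<close>
    have up_low: "{2..m + 1} \<subseteq> X" if "2 \<in> X" "3 \<in> X"
    proof (rule forcing_ascending[OF closed, where a = 3])
      show "{2..3} \<subseteq> X" using that atLeastAtMost_add_1[of 2] by simp
    qed (use mkn in \<open>auto simp: nb\<close>)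
    have up_high: "{a..n} \<subseteq> X"
      if "m + 1 \<le> a" "a \<in> X" "a + 1 \<in> X" "1 \<in> X \<or> m + 2 + k \<le> a + 1" for a
      by (rule forcing_ascending[OF closed, where a = "a + 1"])
        (use that mkn m(2) in \<open>auto simp: nb atLeastAtMost_add_1[simplified]\<close>)
    have down_low: "{2..b + 1} \<subseteq> X" if "b \<le> m" "b \<in> X" "b + 1 \<in> X" for b
      by (rule forcing_descending[OF closed, where b = b])
        (use that mkn in \<open>auto simp: nb atLeastAtMost_add_1[simplified]\<close>)
    have down_high: "{m + 1..n} \<subseteq> X" if "1 \<in> X" "n \<in> X"
      by (rule forcing_descending[OF closed, where b = n])
        (use that mkn m(2) in \<open>auto simp: nb\<close>)
    have from_1_n: "{1..n} \<subseteq> X" if "1 \<in> X" "n \<in> X"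
    proof -
      note high = down_high[OF that]
      \<comment> \<open>All other neighbours of \<open>1\<close> lie in the high block, so
        \<open>1\<close> forces \<open>2\<close>. Then \<open>m + 1\<close> has only
        \<open>m\<close> left to force, which opens the low block.\<close>
      have "2 \<in> X"
        by (rule forcing_closedD[OF closed that(1)])
          (use high that mkn in \<open>auto simp: nb subset_iff\<close>)
      moreover have m1: "m + 1 \<in> X" and "m + 2 \<in> X" using high mkn by auto
      ultimately have "m \<in> X"
        by (intro forcing_closedD[OF closed m1]) (use mkn m in \<open>auto simp: nb\<close>)
      then have "{2..m + 1} \<subseteq> X" using m1 by (intro down_low) auto
      moreover have "x = 1 \<or> x \<in> {2..m + 1} \<or> x \<in> {m + 1..n}" if "x \<in> {1..n}" for x
        using that by auto
      ultimately show ?thesis using high that(1) by blast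
    qed
    have from_2_3: "{1..n} \<subseteq> X" if "2 \<in> X" "3 \<in> X"
    proof -
      have mX: "m \<in> X" "m + 1 \<in> X" using up_low[OF that] m by auto
      \<comment> \<open>With both ends of the extra chord observed, \<open>2\<close> forces
        \<open>1\<close> and \<open>m + 1\<close> forces \<open>m + 2\<close>.\<close>
      have 1: "1 \<in> X"
        by (rule forcing_closedD[OF closed that(1)])
          (use that mX mkn m in \<open>auto simp: nb numeral_3_eq_3 numeral_2_eq_2\<close>)
      have "m + 2 \<in> X"
        by (rule forcing_closedD[OF closed mX(2)]) (use that mX mkn m in \<open>auto simp: nb\<close>)
      then have "{m + 1..n} \<subseteq> X" using 1 mX(2) by (intro up_high) auto
      then show ?thesis using 1 mkn by (intro from_1_n) auto
    qed
    consider "v = 1" | "v = 2" | "3 \<le> v" "v \<le> m + 1" | "m + 2 \<le> v" using v by linarith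
    then have "{1..n} \<subseteq> X"
    proof cases
      case 1
      then show ?thesis by (intro from_1_n) (auto intro!: nbv simp: nb)
    next
      case 2
      then show ?thesis using assms by (intro from_2_3) (auto intro!: nbv simp: nb)
    next
      case 3
      obtain u where u: "v = u + 1" using 3 by (cases v) auto
      have "u \<in> X" "u + 1 \<in> X" using 3 u mkn by (auto intro!: nbv simp: nb)
      then have "{2..u + 1} \<subseteq> X" using 3 u by (intro down_low) auto
      then show ?thesis using 3 u by (intro from_2_3) auto
    next
      case 4
      obtain u where u: "v = u + 1" using 4 by (cases v) auto
      have uX: "u \<in> X" "u + 1 \<in> X" using 4 v u by (auto intro!: nbv simp: nb)
      \<comment> \<open>A start in this range either is a fan end and sees \<open>1\<close>, or lies
        beyond the fan.\<close>
      have "1 \<in> X \<or> m + 2 + k \<le> v" using 4 by (auto intro!: nbv simp: nb)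
      then have "{u..n} \<subseteq> X" using 4 u uX by (intro up_high) auto
      then have n: "n \<in> X" "n - 1 \<in> X" using v u by auto
      then have "1 \<in> X"
        by (intro forcing_closedD[OF closed n(1)]) (use mkn in \<open>auto simp: nb\<close>)
      then show ?thesis using n by (intro from_1_n)
    qed
    then show ?thesis by (simp add: G_def)
  qed
  then show ?thesis unfolding G_def singletons_dominate_def by blast
qed

theorem theorem4:
  fixes G :: "'a pair_pre_digraph"
  assumes "simple_graph G"
    and "(\<exists>n\<ge>5. graph_iso G (complement_graph (cycle_graph n)))
      \<or> (\<exists>n\<ge>4. graph_iso G (complement_graph (path_graph n)))
      \<or> (\<exists>n i k. i \<ge> 3 \<and> n \<ge> 4 \<and> i + k \<le> n - 1
            \<and> graph_iso G (add_edges (cycle_graph n) {{1, j} | j. i \<le> j \<and> j < i + k}))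
      \<or> (\<exists>n i k. i \<ge> 5 \<and> n \<ge> 6 \<and> i + k \<le> n - 1
            \<and> graph_iso G (add_edges (cycle_graph n)
                ({{1, j} | j. i \<le> j \<and> j < i + k} \<union> {{2, i - 1}})))
      \<or> (\<exists>(G' :: 'b pair_pre_digraph) (H :: 'c pair_pre_digraph).
            simple_graph G' \<and> simple_graph H
            \<and> failed_pd_number G' = 0
            \<and> (failed_pd_number H = 0 \<or> graph_iso H (complement_graph (complete_graph 2)))
            \<and> graph_iso G (join_graph G' H))"
  shows "failed_pd_number G = 0"
proof -
  have "singletons_dominate G"
    using assms(2)
  proof (elim disjE exE conjE)
    fix G' :: "'b pair_pre_digraph" and H :: "'c pair_pre_digraph"
    assume *: "simple_graph G'" "simple_graph H" "failed_pd_number G' = 0" "failed_pd_number H = 0"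
      "graph_iso G (join_graph G' H)"
    show ?thesis
      by (rule singletons_dominate_iso[OF *(5) assms(1) singletons_dominate_join])
        (use * failed_pd_number_eq_0_iff in auto)
  next
    fix G' :: "'b pair_pre_digraph" and H :: "'c pair_pre_digraph"
    assume *: "simple_graph G'" "simple_graph H" "failed_pd_number G' = 0"
      "graph_iso H (complement_graph (complete_graph 2))" "graph_iso G (join_graph G' H)"
    show ?thesis
      by (rule singletons_dominate_iso[OF *(5) assms(1) singletons_dominate_join])
        (use * failed_pd_number_eq_0_iff in auto)
  \<comment> \<open>The four concrete families remain, each transferred along its
    isomorphism.\<close>
  qed (erule singletons_dominate_iso[OF _ assms(1)];
      intro singletons_dominate_complement_cycle singletons_dominate_complement_path
        singletons_dominate_cycle_fan singletons_dominate_cycle_fan_chord; assumption)+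
  then show ?thesis by (simp add: failed_pd_number_eq_0_iff[OF assms(1)])
qed

end
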